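(* For every positive integer $k$, the $q,t$-Catalan number $C_{(k,k,k,k)}(q,t)$ is $q,t$-symmetric, i.e. $C_{(k,k,k,k)}(q,t)=C_{(k,k,k,k)}(t,q)$ as polynomials in $q,t$.
   Context: Let $k$ be a positive integer. A $(k,k,k,k)$-Dyck path (also called a $k^4$-Dyck path) is a lattice path starting and ending at level $0$ and never going below level $0$, with four red up steps of height $k$ and $4k$ blue down steps of height $1$, the first step being red. It is uniquely determined by parameters $(a,b,c)$: a red step, then $a$ blue steps, a red step, then $b$ blue steps, a red step, then $c$ blue steps, a red step, and then $4k-a-b-c$ blue steps. The set $\mathcal{D}_{k^4}$ of such paths is in bijection with the integer triples $(a,b,c)$ satisfying $$0\le a\le k,\qquad 0\le b\le 2k-a,\qquad 0\le c\le 3k-a-b.$$ For $D\in\mathcal{D}_{k^4}$ with parameters $(a,b,c)$, the statistics area and bounce are as follows: $$\mathrm{area}(D)=6k-3a-2b-c,$$ and $\mathrm{bounce}(D)$ is given by: 1. If $b\ge 2k-2a$: - $6a+3b+c-4k$, if $c\ge 4k-2a-2b$; - $5a+2b+\left\lceil\frac{c}{2}\right\rceil-2k$, if $c<4k-2a-2b$. 2. If $b<2k-2a$ and $b$ is even: - $4a+2b+c-2k$, if $c\ge 3k-a-\frac{3b}{2}$; - $2a+\frac{b}{2}+k+\left\lceil\frac{3a+\frac{3b}{2}+c-3k}{2}\right\rceil$, if $3k-3a-\frac{3b}{2}\le c<3k-a-\frac{3b}{2}$; - $3a+b+\left\lceil\frac{c}{3}\right\rceil$, if $c<3k-3a-\frac{3b}{2}$.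 3. If $b<2k-2a$ and $b$ is odd: - $4a+2b+c-2k+1$, if $c\ge 3k-a-\frac{3(b+1)}{2}+1$; - $2a+\frac{b+1}{2}+k+\left\lceil\frac{3a+\frac{3(b+1)}{2}+c-3k-1}{2}\right\rceil$, if $3k-3a-\frac{3(b+1)}{2}+1\le c<3k-a-\frac{3(b+1)}{2}+1$; - $3a+b+1+\left\lceil\frac{c-1}{3}\right\rceil$, if $c<3k-3a-\frac{3(b+1)}{2}+1$. The $q,t$-Catalan number is $$C_{(k,k,k,k)}(q,t)=\sum_{D\in\mathcal{D}_{k^4}}q^{\mathrm{area}(D)}t^{\mathrm{bounce}(D)}.$$ *)

theory Defs
  imports "HOL-Computational_Algebra.Polynomial"
begin

datatype step = Red | Blue

fun rise :: "nat \<Rightarrow> step \<Rightarrow> int" where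
  "rise k Red = int k"
| "rise k Blue = -1"

definition level :: "nat \<Rightarrow> step list \<Rightarrow> int" where
  "level k p = sum_list (map (rise k) p)"

definition dyck_paths :: "nat \<Rightarrow> step list set" where
  "dyck_paths k =
     {p. count_list p Red = 4 \<and> count_list p Blue = 4 * k \<and> hd p = Red \<and>
         level k p = 0 \<and> (\<forall>i\<le>length p. 0 \<le> level k (take i p))}"

text \<open>The number of blue steps of a path that are preceded by exactly \<open>i\<close> red steps; the
  parameters \<open>(a, b, c)\<close> of a path are the values for \<open>i = 1, 2, 3\<close>.\<close>

fun blue_run :: "nat \<Rightarrow> step list \<Rightarrow> nat" where
  "blue_run i [] = 0"
| "blue_run 0 (Red # p) = 0"
| "blue_run (Suc i) (Red # p) = blue_run i p"
| "blue_run 0 (Blue # p) = Suc (blue_run 0 p)"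
| "blue_run (Suc i) (Blue # p) = blue_run (Suc i) p"

definition params :: "step list \<Rightarrow> nat \<times> nat \<times> nat" where
  "params p = (blue_run 1 p, blue_run 2 p, blue_run 3 p)"

definition area_formula :: "int \<Rightarrow> int \<Rightarrow> int \<Rightarrow> int \<Rightarrow> int" where
  "area_formula k a b c = 6*k - 3*a - 2*b - c"

text \<open>Every \<open>div 2\<close> below is applied to an even number.\<close>

definition bounce_formula :: "int \<Rightarrow> int \<Rightarrow> int \<Rightarrow> int \<Rightarrow> int" where
  "bounce_formula k a b c =
    (if b \<ge> 2*k - 2*a then
       if c \<ge> 4*k - 2*a - 2*b then 6*a + 3*b + c - 4*k
       else 5*a + 2*b + \<lceil>rat_of_int c / 2\<rceil> - 2*k
     else if even b then
       if c \<ge> 3*k - a - 3*b div 2 then 4*a + 2*b + c - 2*k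
       else if c \<ge> 3*k - 3*a - 3*b div 2 then
         2*a + b div 2 + k + \<lceil>rat_of_int (3*a + 3*b div 2 + c - 3*k) / 2\<rceil>
       else 3*a + b + \<lceil>rat_of_int c / 3\<rceil>
     else
       if c \<ge> 3*k - a - 3*(b + 1) div 2 + 1 then 4*a + 2*b + c - 2*k + 1
       else if c \<ge> 3*k - 3*a - 3*(b + 1) div 2 + 1 then
         2*a + (b + 1) div 2 + k + \<lceil>rat_of_int (3*a + 3*(b + 1) div 2 + c - 3*k - 1) / 2\<rceil>
       else 3*a + b + 1 + \<lceil>rat_of_int (c - 1) / 3\<rceil>)"

definition area :: "nat \<Rightarrow> step list \<Rightarrow> int" where
  "area k p = (case params p of (a, b, c) \<Rightarrow> area_formula (int k) (int a) (int b) (int c))"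

definition bounce :: "nat \<Rightarrow> step list \<Rightarrow> int" where
  "bounce k p = (case params p of (a, b, c) \<Rightarrow> bounce_formula (int k) (int a) (int b) (int c))"

text \<open>The exponents are natural numbers, since both statistics are nonnegative on
  \<open>dyck_paths k\<close>; see \<open>area_nonneg\<close> and \<open>bounce_nonneg\<close> below.\<close>

definition qt_catalan :: "nat \<Rightarrow> 'a::comm_semiring_1 \<Rightarrow> 'a \<Rightarrow> 'a" where
  "qt_catalan k q t = (\<Sum>p\<in>dyck_paths k. q ^ nat (area k p) * t ^ nat (bounce k p))"

text \<open>The two indeterminates of \<open>\<int>[q][t]\<close>.\<close>

definition var_q :: "int poly poly" where
  "var_q = [:[:0, 1:]:]"

definition var_t :: "int poly poly" where
  "var_t = [:0, 1:]"


definition param_triples :: "nat \<Rightarrow> (nat \<times> nat \<times> nat) set" where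
  "param_triples k = {(a, b, c). a \<le> k \<and> a + b \<le> 2 * k \<and> a + b + c \<le> 3 * k}"

definition path_of :: "nat \<Rightarrow> nat \<times> nat \<times> nat \<Rightarrow> step list" where
  "path_of k = (\<lambda>(a, b, c). Red # replicate a Blue @ Red # replicate b Blue @ Red #
     replicate c Blue @ Red # replicate (4 * k - a - b - c) Blue)"

definition nonneg_from :: "nat \<Rightarrow> int \<Rightarrow> step list \<Rightarrow> bool" where
  "nonneg_from k h p \<longleftrightarrow> (\<forall>i\<le>length p. 0 \<le> h + level k (take i p))"

lemma nonneg_from_Nil: "nonneg_from k h [] \<longleftrightarrow> 0 \<le> h"
  by (simp add: nonneg_from_def level_def)

lemma nonneg_from_Cons: "nonneg_from k h (x # p) \<longleftrightarrow> 0 \<le> h \<and> nonneg_from k (h + rise k x) p"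
proof -
  have "(\<forall>i\<le>Suc n. P i) \<longleftrightarrow> P 0 \<and> (\<forall>i\<le>n. P (Suc i))" for n and P :: "nat \<Rightarrow> bool"
    by (metis Suc_le_mono le0 not0_implies_Suc)
  then show ?thesis
    by (simp add: nonneg_from_def level_def add.assoc)
qed

lemma nonneg_from_imp: "nonneg_from k h p \<Longrightarrow> 0 \<le> h"
  by (cases p) (auto simp: nonneg_from_Nil nonneg_from_Cons)

lemma nonneg_from_Blues:
  "nonneg_from k h (replicate n Blue @ p) \<longleftrightarrow> nonneg_from k (h - int n) p"
proof (induction n arbitrary: h)
  case (Suc n)
  have "nonneg_from k (h - 1 - int n) p \<Longrightarrow> 0 \<le> h"
    using nonneg_from_imp by fastforce
  moreover have "h - int (Suc n) = h - 1 - int n"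
    by simp
  moreover have "nonneg_from k h (replicate (Suc n) Blue @ p) \<longleftrightarrow>
      0 \<le> h \<and> nonneg_from k (h - 1) (replicate n Blue @ p)"
    by (simp add: nonneg_from_Cons)
  ultimately show ?case
    using Suc.IH[of "h - 1"] by metis
qed simp

lemma nonneg_from_Blues': "nonneg_from k h (replicate n Blue) \<longleftrightarrow> int n \<le> h"
  using nonneg_from_Blues[of k h n "[]"] by (simp add: nonneg_from_Nil)

lemma level_simps [simp]:
  "level k [] = 0" "level k (x # p) = rise k x + level k p"
  "level k (p @ p') = level k p + level k p'" "level k (replicate n x) = int n * rise k x"
  by (simp_all add: level_def sum_list_replicate)

lemma no_Red: "count_list p Red = 0 \<Longrightarrow> p = replicate (count_list p Blue) Blue"
proof (induction p)
  case (Cons x p)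
  then show ?case by (cases x) auto
qed simp

lemma first_Red:
  assumes "count_list p Red = Suc n"
  obtains m p' where "p = replicate m Blue @ Red # p'" "count_list p' Red = n"
proof -
  have "\<exists>m p'. p = replicate m Blue @ Red # p' \<and> count_list p' Red = n"
    using assms
  proof (induction p)
    case (Cons x p)
    show ?case
    proof (cases x)
      case Red
      then show ?thesis using Cons.prems by (intro exI[of _ 0] exI[of _ p]) simp
    next
      case Blue
      then obtain m p' where "p = replicate m Blue @ Red # p'" "count_list p' Red = n"
        using Cons by auto
      then show ?thesis using Blue by (intro exI[of _ "Suc m"] exI[of _ p']) simp
    qed
  qed simp
  then show ?thesis using that by blast
qed

lemma count_list_replicate': "count_list (replicate n x) y = (if x = y then n else 0)"
  by (induction n) auto

lemma dyck_pathE: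
  assumes "p \<in> dyck_paths k"
  obtains x where "x \<in> param_triples k" "p = path_of k x"
proof -
  have cnt: "count_list p Red = Suc (Suc (Suc (Suc 0)))" "count_list p Blue = 4 * k"
    and hd: "hd p = Red" and nn: "nonneg_from k 0 p"
    using assms by (simp_all add: dyck_paths_def nonneg_from_def)
  obtain m p1 where p1: "p = replicate m Blue @ Red # p1" "count_list p1 Red = Suc (Suc (Suc 0))"
    using first_Red[OF cnt(1)] .
  obtain a p2 where p2: "p1 = replicate a Blue @ Red # p2" "count_list p2 Red = Suc (Suc 0)"
    using first_Red[OF p1(2)] .
  obtain b p3 where p3: "p2 = replicate b Blue @ Red # p3" "count_list p3 Red = Suc 0"
    using first_Red[OF p2(2)] .
  obtain c p4 where p4: "p3 = replicate c Blue @ Red # p4" "count_list p4 Red = 0"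
    using first_Red[OF p3(2)] .
  obtain d where d: "p4 = replicate d Blue"
    using no_Red[OF p4(2)] by blast
  have m: "m = 0"
    using hd p1(1) by (cases m) auto
  have p: "p = Red # replicate a Blue @ Red # replicate b Blue @ Red #
      replicate c Blue @ Red # replicate d Blue"
    using m p1 p2 p3 p4 d by simp
  have sum: "a + b + c + d = 4 * k"
    using cnt(2) unfolding p by (simp add: count_list_replicate')
  have le: "a \<le> k" "a + b \<le> 2 * k" "a + b + c \<le> 3 * k"
    using nn unfolding p
    by (auto simp: nonneg_from_Cons nonneg_from_Blues nonneg_from_Blues')
  have "d = 4 * k - a - b - c"
    using sum by simp
  then show ?thesis
    using that[of "(a, b, c)"] p le by (simp add: param_triples_def path_of_def)
qed

lemma path_of_dyck:
  assumes "x \<in> param_triples k"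
  shows "path_of k x \<in> dyck_paths k"
proof -
  obtain a b c where x: "x = (a, b, c)" and le: "a \<le> k" "a + b \<le> 2 * k" "a + b + c \<le> 3 * k"
    using assms by (auto simp: param_triples_def)
  have "nonneg_from k 0 (path_of k x)"
    using le
    by (auto simp: x path_of_def nonneg_from_Cons nonneg_from_Blues nonneg_from_Blues')
  then show ?thesis
    using le by (auto simp: dyck_paths_def nonneg_from_def x path_of_def count_list_replicate')
qed

lemma blue_run_Blues:
  "blue_run 0 (replicate n Blue @ p) = n + blue_run 0 p"
  "blue_run (Suc i) (replicate n Blue @ p) = blue_run (Suc i) p"
  by (induction n) auto

lemma params_path_of: "params (path_of k x) = x"
  by (cases x) (simp add: params_def path_of_def blue_run_Blues numeral_eq_Suc)

lemma bij_betw_params: "bij_betw params (dyck_paths k) (param_triples k)"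
proof (rule bij_betw_byWitness[where f' = "path_of k"])
  show "\<forall>p\<in>dyck_paths k. path_of k (params p) = p"
    by (metis dyck_pathE params_path_of)
  show "params ` dyck_paths k \<subseteq> param_triples k"
    by (auto elim!: dyck_pathE simp: params_path_of)
qed (auto simp: params_path_of intro: path_of_dyck)

lemma finite_dyck_paths: "finite (dyck_paths k)"
proof -
  have "param_triples k \<subseteq> {..k} \<times> {..2 * k} \<times> {..3 * k}"
    by (auto simp: param_triples_def)
  then have "finite (param_triples k)"
    by (rule finite_subset) simp
  then show ?thesis
    using bij_betw_finite[OF bij_betw_params] by simp
qed

lemma params_le:
  assumes "p \<in> dyck_paths k" "params p = (a, b, c)"
  shows "a \<le> k" "a + b \<le> 2 * k" "a + b + c \<le> 3 * k"
  using bij_betwE[OF bij_betw_params, of k] assms by (auto simp: param_triples_def)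

lemma area_nonneg: "p \<in> dyck_paths k \<Longrightarrow> 0 \<le> area k p"
  by (cases "params p") (use params_le[of p k] in \<open>force simp: area_def area_formula_def\<close>)

lemma ceiling_rat_div:
  "\<lceil>rat_of_int x / 2\<rceil> = - (- x div 2)" "\<lceil>rat_of_int x / 3\<rceil> = - (- x div 3)"
  using ceiling_divide_eq_div[of x 2] ceiling_divide_eq_div[of x 3] by simp_all

lemma bounce_formula_nonneg:
  fixes k a b c :: int
  assumes "0 \<le> a" "0 \<le> b" "0 \<le> c" "a \<le> k" "a + b \<le> 2*k" "a + b + c \<le> 3*k"
  shows "0 \<le> bounce_formula k a b c"
proof (cases "even b")
  case True
  then obtain b' where "b = 2 * b'" ..
  then show ?thesis
    using assms unfolding bounce_formula_def ceiling_rat_div by (auto; presburger)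
next
  case False
  then obtain b' where "b = 2 * b' + 1" by (elim oddE)
  then show ?thesis
    using assms unfolding bounce_formula_def ceiling_rat_div by (auto; presburger)
qed

lemma bounce_nonneg: "p \<in> dyck_paths k \<Longrightarrow> 0 \<le> bounce k p"
proof -
  assume p: "p \<in> dyck_paths k"
  obtain a b c where abc: "params p = (a, b, c)"
    by (cases "params p")
  show ?thesis
    unfolding bounce_def abc prod.case
    by (rule bounce_formula_nonneg) (use params_le[OF p abc] in auto)
qed

end

(* Replacing (k, a, b, c) by (k + 1, a, b + 2, c) raises both area and bounce by 2, and the triples
   for k + 1 not reached this way are those with b < 2, a = k + 1 or a + b + c = 3 (k + 1).
   On these boundary triples, which form two-dimensional families, (area, bounce) is injective and
   its image is cut out by conditions that are symmetric in the two coordinates. So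
   C_{k+1}(q,t) = q^2 t^2 C_k(q,t) + R_{k+1}(q,t) with R_{k+1} symmetric, and induction applies. *)

theory Submission
  imports Defs
begin

definition triples :: "int \<Rightarrow> (int \<times> int \<times> int) set" where
  "triples k = {(a, b, c). 0 \<le> a \<and> 0 \<le> b \<and> 0 \<le> c \<and> a \<le> k \<and> a + b \<le> 2*k \<and> a + b + c \<le> 3*k}"

definition boundary_triples :: "int \<Rightarrow> (int \<times> int \<times> int) set" where
  "boundary_triples k = {(a, b, c) \<in> triples k. b < 2 \<or> a = k \<or> a + b + c = 3*k}"

definition exponents :: "int \<Rightarrow> int \<times> int \<times> int \<Rightarrow> int \<times> int" where
  "exponents k = (\<lambda>(a, b, c). (area_formula k a b c, bounce_formula k a b c))"

text \<open>For \<open>k >= 0\<close> these are the lattice points of the trapezoid with corners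
  \<open>(6*k, 0)\<close>, \<open>(0, 6*k)\<close>, \<open>(k, 3*k)\<close>,
  \<open>(3*k, k)\<close>, with every other point of the side \<open>m + n = 4*k\<close>
  removed.\<close>

definition boundary_exponents :: "int \<Rightarrow> (int \<times> int) set" where
  "boundary_exponents k = {(m, n). m + n \<le> 6*k \<and> 6*k \<le> m + 3*n \<and> 6*k \<le> 3*m + n \<and>
     4*k \<le> m + n \<and> (m + n = 4*k \<longrightarrow> even (m - k))}"

text \<open>The inverse of \<^term>\<open>exponents k\<close> on \<^term>\<open>boundary_exponents k\<close>. Its branches
  hit, in this order, the faces \<open>a + b + c = 3 k\<close> (with \<open>b \<ge> 2 k - 2 a\<close>), \<open>a = k\<close> (with \<open>c \<ge> 2 k - 2 b\<close>),
  \<open>a + b + c = 3 k\<close> (with \<open>b < 2 k - 2 a\<close>), \<open>a = k\<close> (with \<open>c < 2 k - 2 b\<close>) and \<open>b < 2\<close>.\<close>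

definition boundary_triple :: "int \<Rightarrow> int \<times> int \<Rightarrow> int \<times> int \<times> int" where
  "boundary_triple k = (\<lambda>(m, n).
     let e = (m - k) mod 2; a = m + n - 4*k - e; c = 2*(6*k - m - n) + e;
         h = n - (if m \<le> 3*k then k - (m - 3*k) div 2 else - ((m - 6*k) div 3))
     in if m \<le> k \<and> 2*m + n < 6*k then
          (2*m + n - 5*k, 13*k - 5*m - 2*n, 3*m + n - 5*k)
        else if m \<le> k then (k, m + n - 5*k, 13*k - 3*m - 2*n)
        else if 0 \<le> a \<and> 2*a \<le> 3*k - m then (a, 3*k - m - 2*a, m + a)
        else if c \<le> 3*k - m then (k, (3*k - m - c) div 2, c)
        else (h div 2, h mod 2, 6*k - m - 3*(h div 2) - 2*(h mod 2)))"

section \<open>Finiteness, and the bounce under the shift and on the boundary faces\<close>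

lemma finite_triples: "finite (triples k)"
proof (rule finite_subset)
  show "triples k \<subseteq> {0..k} \<times> {0..2*k} \<times> {0..3*k}"
    by (auto simp: triples_def)
qed simp

text \<open>Raising \<open>k\<close> by 1 and \<open>b\<close> by 2 keeps the parity of
  \<open>b\<close>, its comparison with \<open>2*k - 2*a\<close> and every threshold on
  \<open>c\<close>; each branch then grows by exactly 2.\<close>

lemma bounce_formula_shift:
  "bounce_formula (k + 1) a (b + 2) c = bounce_formula k a b c + 2"
proof (cases "even b")
  case True
  then obtain b' where "b = 2 * b'" ..
  then show ?thesis
    unfolding bounce_formula_def ceiling_rat_div by (auto; presburger)
next
  case False
  then obtain b' where "b = 2 * b' + 1" by (elim oddE)
  then show ?thesis
    unfolding bounce_formula_def ceiling_rat_div by (auto; presburger)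
qed

text \<open>With \<open>c = 3*k - a - b\<close> the first threshold on \<open>c\<close> is always
  met, so one branch per parity survives; \<open>b mod 2\<close> is the extra 1 of the odd
  branch.\<close>

lemma bounce_formula_top:
  assumes "0 \<le> a" "0 \<le> b" "b < 2*k - 2*a" "a + b + c = 3*k"
  shows "bounce_formula k a b c = 3*a + b + k + b mod 2"
proof (cases "even b")
  case True
  then obtain b' where "b = 2 * b'" ..
  then show ?thesis
    using assms unfolding bounce_formula_def ceiling_rat_div by (auto; presburger)
next
  case False
  then obtain b' where "b = 2 * b' + 1" by (elim oddE)
  then show ?thesis
    using assms unfolding bounce_formula_def ceiling_rat_div by (auto; presburger)
qed

text \<open>Once the area \<open>m\<close> is fixed, only \<open>2*a + b\<close> matters, so
  \<open>a\<close> and \<open>b\<close> can be read off as quotient and remainder by 2. The test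
  \<open>m <= 3*k\<close> is the second threshold on \<open>c\<close>.\<close>

lemma bounce_formula_low:
  assumes "0 \<le> a" "a < k" "b = 0 \<or> b = 1" "a + b + c \<le> 3*k" "m = 6*k - 3*a - 2*b - c"
  shows "bounce_formula k a b c =
    2*a + b + (if m \<le> 3*k then k - (m - 3*k) div 2 else - ((m - 6*k) div 3))"
  using assms(3)
proof
  assume "b = 0"
  then show ?thesis
    using assms unfolding bounce_formula_def ceiling_rat_div by (auto; presburger)
next
  assume "b = 1"
  then show ?thesis
    using assms unfolding bounce_formula_def ceiling_rat_div by (auto; presburger)
qed

lemma bounce_formula_wide:
  assumes "b \<ge> 2*k - 2*a"
  shows "bounce_formula k a b c =
    (if c \<ge> 4*k - 2*a - 2*b then 6*a + 3*b + c - 4*k else 5*a + 2*b - (- c) div 2 - 2*k)"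
  using assms unfolding bounce_formula_def ceiling_rat_div by simp

text \<open>Here \<open>l\<close> is the bounce minus \<open>2 a + b\<close> on the faces \<open>b = 0\<close> and \<open>b = 1\<close>.\<close>

lemma low_offset_bounds:
  fixes k m :: int
  defines "l \<equiv> if m \<le> 3*k then k - (m - 3*k) div 2 else - ((m - 6*k) div 3)"
  shows "6*k - m \<le> 3*l \<and> 3*l \<le> 6*k - m + 2 \<and> 3*k < m
      \<or> 2*l = 5*k - m + (m - k) mod 2 \<and> m \<le> 3*k"
proof (cases "m \<le> 3*k")
  case True
  have "(m - k) mod 2 = (m - 3*k) mod 2"
    by presburger
  moreover have "2*((m - 3*k) div 2) + (m - 3*k) mod 2 = m - 3*k"
    by (rule mult_div_mod_eq)
  ultimately have "2*k - 2*((m - 3*k) div 2) = 5*k - m + (m - k) mod 2"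
    by linarith
  then show ?thesis
    using True unfolding l_def by simp
next
  case False
  have "3*((m - 6*k) div 3) + (m - 6*k) mod 3 = m - 6*k"
    by (rule mult_div_mod_eq)
  moreover have "0 \<le> (m - 6*k) mod 3" "(m - 6*k) mod 3 < 3"
    by simp_all
  ultimately have "6*k - m \<le> 3*(- ((m - 6*k) div 3))" "3*(- ((m - 6*k) div 3)) \<le> 6*k - m + 2"
    by linarith+
  then show ?thesis
    using False unfolding l_def by simp
qed

section \<open>The bijection between boundary triples and boundary exponents\<close>

lemma exponents_boundary_triples:
  assumes "x \<in> boundary_triples k"
  shows "exponents k x \<in> boundary_exponents k \<and> boundary_triple k (exponents k x) = x"
proof -
  obtain a b c where x: "x = (a, b, c)" by (cases x)
  have abc: "0 \<le> a" "0 \<le> b" "0 \<le> c" "a \<le> k" "a + b \<le> 2*k" "a + b + c \<le> 3*k"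
    and bd: "b < 2 \<or> a = k \<or> a + b + c = 3*k"
    using assms by (auto simp: x boundary_triples_def triples_def)
  define m n where "m = area_formula k a b c" and "n = bounce_formula k a b c"
  then have ex: "exponents k x = (m, n)" and m: "m = 6*k - 3*a - 2*b - c"
    by (simp_all add: x exponents_def area_formula_def)
  define e where "e = (m - k) mod 2"
  have e: "e = 0 \<or> e = 1" by (auto simp: e_def)
  have T: "boundary_triple k (m, n) =
    (let a' = m + n - 4*k - e; c' = 2*(6*k - m - n) + e;
         h = n - (if m \<le> 3*k then k - (m - 3*k) div 2 else - ((m - 6*k) div 3))
     in if m \<le> k \<and> 2*m + n < 6*k then
          (2*m + n - 5*k, 13*k - 5*m - 2*n, 3*m + n - 5*k)
        else if m \<le> k then (k, m + n - 5*k, 13*k - 3*m - 2*n)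
        else if 0 \<le> a' \<and> 2*a' \<le> 3*k - m then (a', 3*k - m - 2*a', m + a')
        else if c' \<le> 3*k - m then (k, (3*k - m - c') div 2, c')
        else (h div 2, h mod 2, 6*k - m - 3*(h div 2) - 2*(h mod 2)))"
    by (simp only: boundary_triple_def e_def prod.case Let_def)
  have "even (m - k) \<longleftrightarrow> e = 0"
    by (auto simp: e_def)
  then have B: "(m, n) \<in> boundary_exponents k \<longleftrightarrow> m + n \<le> 6*k \<and> 6*k \<le> m + 3*n \<and>
      6*k \<le> 3*m + n \<and> 4*k \<le> m + n \<and> (m + n = 4*k \<longrightarrow> e = 0)"
    by (simp add: boundary_exponents_def)
  \<comment> \<open>The faces overlap; this split leaves one closed form of the bounce per
    case.\<close>
  consider (wide1) "2*k - 2*a \<le> b" "4*k - 2*a - 2*b \<le> c" "a = k \<or> a + b + c = 3*k"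
    | (wide2) "a = k" "c < 2*k - 2*b"
    | (top) "b < 2*k - 2*a" "a + b + c = 3*k"
    | (low) "a < k" "b = 0 \<or> b = 1" "b < 2*k - 2*a" "a + b + c < 3*k"
    using abc bd by (smt (verit))
  then have "(m, n) \<in> boundary_exponents k \<and> boundary_triple k (m, n) = x"
  proof cases
    case wide1
    then have n: "n = 6*a + 3*b + c - 4*k"
      by (simp add: n_def bounce_formula_wide)
    \<comment> \<open>Here \<open>2*m + n = 8*k - b - c\<close>, which is at least
      \<open>6*k\<close> if \<open>a = k\<close> and equals \<open>5*k + a\<close> if
      \<open>a + b + c = 3*k\<close>; this lets the inverse tell the two faces apart.\<close>
    have "m \<le> k" using wide1 abc m by linarith
    then have "boundary_triple k (m, n) = x"
      using wide1 abc m n unfolding T Let_def x by auto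
    \<comment> \<open>This case meets the line \<open>m + n = 4*k\<close> only at its end point
      \<open>(k, 3*k)\<close>.\<close>
    moreover have "m = k" if "m + n = 4*k"
      using that wide1 abc m n by linarith
    then have "(m, n) \<in> boundary_exponents k"
      using wide1 abc m n unfolding B by (auto simp: e_def)
    ultimately show ?thesis by simp
  next
    case wide2
    then have n: "n = 3*k + 2*b - (- c) div 2"
      using abc by (simp add: n_def bounce_formula_wide)
    \<comment> \<open>As \<open>m = 3*k - 2*b - c\<close>, the parity of \<open>c\<close> is that of
      \<open>m - k\<close>. Then \<open>m + n = 6*k - c'\<close>, which explains the fourth branch
      of the inverse.\<close>
    obtain c' where c: "c = 2*c' + e"
    proof
      show "c = 2*(c div 2) + e"
        using m wide2 unfolding e_def by presburger
    qed
    have n: "n = 3*k + 2*b + c' + e"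
      using n c e by auto
    have "boundary_triple k (m, n) = x"
      using wide2 abc m n c e unfolding T Let_def x by auto
    moreover have "(m, n) \<in> boundary_exponents k"
      using wide2 abc m n c e unfolding B by auto
    ultimately show ?thesis by simp
  next
    case top
    \<comment> \<open>On this face \<open>m = 3*k - 2*a - b\<close>, so
      \<open>m + n = 4*k + a + e\<close> and subtracting \<open>e\<close> recovers
      \<open>a\<close>.\<close>
    have "b mod 2 = e"
      using m top unfolding e_def by presburger
    then have n: "n = 3*a + b + k + e"
      using bounce_formula_top[OF abc(1,2) top] by (simp add: n_def)
    have "boundary_triple k (m, n) = x"
      using top abc m n e unfolding T Let_def x by auto
    moreover have "(m, n) \<in> boundary_exponents k"
      using top abc m n e unfolding B by auto
    ultimately show ?thesis by simp
  next
    case low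
    define l where "l = (if m \<le> 3*k then k - (m - 3*k) div 2 else - ((m - 6*k) div 3))"
    have n: "n = 2*a + b + l"
      using bounce_formula_low[OF abc(1) low(1,2) abc(6) m] by (simp add: n_def l_def)
    have l: "6*k - m \<le> 3*l \<and> 3*l \<le> 6*k - m + 2 \<and> 3*k < m \<or> 2*l = 5*k - m + e \<and> m \<le> 3*k"
      unfolding l_def e_def by (rule low_offset_bounds)
    have nl: "(n - l) div 2 = a" "(n - l) mod 2 = b"
      using low(2) n by auto
    have b: "b \<le> 1" and e': "0 \<le> e" "e \<le> 1"
      using low(2) e by auto
    \<comment> \<open>This and the next two inequalities reject the first four branches of the
      inverse.\<close>
    have "k < m"
      using low abc m b by linarith
    moreover have "3*k - m < 2*m + 2*n - 8*k - 2*e" if "0 \<le> m + n - 4*k - e"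
      using l that low(1,4) abc m n b e' by (elim disjE conjE) linarith+
    moreover have "3*k - m < 12*k - 2*m - 2*n + e"
      using l low(1,4) abc m n b e' by (elim disjE conjE) linarith+
    ultimately have "boundary_triple k (m, n) = x"
      using m unfolding T Let_def x l_def[symmetric] nl by auto
    moreover have "(m, n) \<in> boundary_exponents k"
      using low abc m n e l unfolding B by auto
    ultimately show ?thesis by simp
  qed
  then show ?thesis
    by (simp add: ex)
qed

text \<open>Surjectivity: each branch solves the area and bounce equations of its face, and the
  failed tests together with the inequalities of the region keep the solution among the boundary
  triples.\<close>

lemma boundary_triple_exponents:
  assumes "y \<in> boundary_exponents k"
  shows "boundary_triple k y \<in> boundary_triples k \<and> exponents k (boundary_triple k y) = y"
proof -
  obtain m n where y: "y = (m, n)" by (cases y)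
  define e where "e = (m - k) mod 2"
  have e: "e = 0 \<or> e = 1" by (auto simp: e_def)
  have "even (m - k) \<longleftrightarrow> e = 0"
    by (auto simp: e_def)
  then have B: "m + n \<le> 6*k" "6*k \<le> m + 3*n" "6*k \<le> 3*m + n" "4*k \<le> m + n"
      "m + n = 4*k \<longrightarrow> e = 0"
    using assms by (simp_all add: y boundary_exponents_def)
  define a' where "a' = m + n - 4*k - e"
  define c' where "c' = 2*(6*k - m - n) + e"
  define l where "l = (if m \<le> 3*k then k - (m - 3*k) div 2 else - ((m - 6*k) div 3))"
  have T: "boundary_triple k y =
    (if m \<le> k \<and> 2*m + n < 6*k then
       (2*m + n - 5*k, 13*k - 5*m - 2*n, 3*m + n - 5*k)
     else if m \<le> k then (k, m + n - 5*k, 13*k - 3*m - 2*n)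
     else if 0 \<le> a' \<and> 2*a' \<le> 3*k - m then (a', 3*k - m - 2*a', m + a')
     else if c' \<le> 3*k - m then (k, (3*k - m - c') div 2, c')
     else ((n - l) div 2, (n - l) mod 2, 6*k - m - 3*((n - l) div 2) - 2*((n - l) mod 2)))"
    by (simp only: y boundary_triple_def a'_def c'_def l_def e_def prod.case Let_def)
  have goal: ?thesis
    if "boundary_triple k y = (a, b, c)" "0 \<le> a" "0 \<le> b" "0 \<le> c" "a \<le> k" "a + b \<le> 2*k"
      "a + b + c \<le> 3*k" "b < 2 \<or> a = k \<or> a + b + c = 3*k" "m = 6*k - 3*a - 2*b - c"
      "bounce_formula k a b c = n" for a b c
    using that by (simp add: y exponents_def area_formula_def boundary_triples_def triples_def)
  consider (1) "m \<le> k" "2*m + n < 6*k" | (2) "m \<le> k" "6*k \<le> 2*m + n"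
    | (3) "k < m" "0 \<le> a'" "2*a' \<le> 3*k - m"
    | (4) "k < m" "\<not> (0 \<le> a' \<and> 2*a' \<le> 3*k - m)" "c' \<le> 3*k - m"
    | (5) "k < m" "\<not> (0 \<le> a' \<and> 2*a' \<le> 3*k - m)" "3*k - m < c'"
    by linarith
  then show ?thesis
  proof cases
    case 1
    show ?thesis
    proof (rule goal)
      show "boundary_triple k y = (2*m + n - 5*k, 13*k - 5*m - 2*n, 3*m + n - 5*k)"
        using 1 by (simp add: T)
    qed (use 1 B in \<open>simp_all add: bounce_formula_wide\<close>)
  next
    case 2
    show ?thesis
    proof (rule goal)
      show "boundary_triple k y = (k, m + n - 5*k, 13*k - 3*m - 2*n)"
        using 2 by (simp add: T)
    qed (use 2 B in \<open>simp_all add: bounce_formula_wide\<close>)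
  next
    case 3
    have "(3*k - m - 2*a') mod 2 = e"
      unfolding e_def by presburger
    \<comment> \<open>The condition \<open>b < 2*k - 2*a\<close> of this face reduces to
      \<open>k < m\<close>.\<close>
    moreover have "bounce_formula k a' (3*k - m - 2*a') (m + a') =
        3*a' + (3*k - m - 2*a') + k + (3*k - m - 2*a') mod 2"
      using 3 by (intro bounce_formula_top) auto
    ultimately have n: "bounce_formula k a' (3*k - m - 2*a') (m + a') = n"
      by (simp add: a'_def)
    show ?thesis
    proof (rule goal)
      show "boundary_triple k y = (a', 3*k - m - 2*a', m + a')"
        using 3 by (simp add: T)
    qed (use 3 B n in simp_all)
  next
    case 4
    \<comment> \<open>\<open>c'\<close> has the parity of \<open>m - k\<close>, so the halving in
      the fourth branch is exact.\<close>
    obtain b where b: "3*k - m - c' = 2*b"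
    proof
      show "3*k - m - c' = 2*((3*k - m - c') div 2)"
        unfolding c'_def e_def by presburger
    qed
    have "(- c') div 2 = m + n - 6*k - e"
      using e by (auto simp: c'_def)
    moreover have range: "0 \<le> c'" "c' < 2*k - 2*b" "0 \<le> b" "b \<le> k"
      using 4(1,3) b B(1) e c'_def by auto
    ultimately have n: "bounce_formula k k b c' = n"
      using b c'_def by (simp add: bounce_formula_wide)
    show ?thesis
    proof (rule goal)
      show "boundary_triple k y = (k, b, c')"
        using 4 by (simp only: T b) simp
    qed (use range b n in simp_all)
  next
    case 5
    define a b where "a = (n - l) div 2" and "b = (n - l) mod 2"
    have n: "n = 2*a + b + l" and b: "b = 0 \<or> b = 1"
      by (auto simp: a_def b_def)
    define c where "c = 6*k - m - 3*a - 2*b"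
    have l: "6*k - m \<le> 3*l \<and> 3*l \<le> 6*k - m + 2 \<and> 3*k < m \<or> 2*l = 5*k - m + e \<and> m \<le> 3*k"
      unfolding l_def e_def by (rule low_offset_bounds)
    have b': "0 \<le> b" "b \<le> 1" and e': "0 \<le> e" "e \<le> 1"
      using b e by auto
    \<comment> \<open>\<open>a' < 0\<close> would force \<open>m + n = 4*k\<close> and
      \<open>e = 1\<close>, which the parity condition excludes.\<close>
    have low: "3*k < m \<or> 3*k - m < 2*m + 2*n - 8*k - 2*e"
      using 5(2) B(4,5) e unfolding a'_def by auto
    \<comment> \<open>The failed fourth test caps \<open>n\<close>; this bounds \<open>a\<close>
      from above and \<open>c\<close> from below.\<close>
    have "2*n < 9*k - m + e"
      using 5(3) unfolding c'_def by simp
    have "l \<le> n"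
      using l low B(2) e' by (elim disjE conjE) linarith+
    then have a0: "0 \<le> a"
      using n b' by linarith
    have ak: "a < k"
    proof (rule ccontr)
      assume "\<not> a < k"
      then have "2*k + l \<le> n"
        using n b' by linarith
      then show False
        using l \<open>2*n < 9*k - m + e\<close> e' by (elim disjE conjE) linarith+
    qed
    have c0: "0 \<le> c"
      using l \<open>2*n < 9*k - m + e\<close> B(1) n b' e' unfolding c_def by (elim disjE conjE) linarith+
    have abc: "a + b + c \<le> 3*k"
      using l low \<open>l \<le> n\<close> n b' e' unfolding c_def by (elim disjE conjE) linarith+
    have m: "m = 6*k - 3*a - 2*b - c"
      by (simp add: c_def)
    show ?thesis
    proof (rule goal)
      show "boundary_triple k y = (a, b, c)"
        unfolding T a_def[symmetric] b_def[symmetric] c_def[symmetric] using 5 by auto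
      show "bounce_formula k a b c = n"
        using bounce_formula_low[OF a0 ak b abc m, folded l_def] n by simp
      show "a + b \<le> 2*k"
        using a0 ak b' by linarith
      show "b < 2 \<or> a = k \<or> a + b + c = 3*k"
        using b' by simp
    qed (use a0 ak b' c0 abc m in simp_all)
  qed
qed

section \<open>Symmetry of the boundary sum\<close>

lemma sum_boundary_triples:
  "(\<Sum>x\<in>boundary_triples k. f (exponents k x)) = sum f (boundary_exponents k)"
  by (rule sum.reindex_bij_witness[where j = "exponents k" and i = "boundary_triple k"])
    (simp_all add: exponents_boundary_triples boundary_triple_exponents)

text \<open>The parity condition survives the swap because \<open>m - k\<close> and
  \<open>n - k\<close> add up to \<open>2*k\<close> on the line \<open>m + n = 4*k\<close>.\<close>

lemma sum_boundary_exponents_swap: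
  "(\<Sum>y\<in>boundary_exponents k. f (prod.swap y)) = sum f (boundary_exponents k)"
proof (rule sum.reindex_bij_witness[where i = prod.swap and j = prod.swap])
  have "prod.swap y \<in> boundary_exponents k" if "y \<in> boundary_exponents k" for y
    using that unfolding boundary_exponents_def by (auto; presburger)
  then show "\<And>y. y \<in> boundary_exponents k \<Longrightarrow> prod.swap y \<in> boundary_exponents k"
    "\<And>y. y \<in> boundary_exponents k \<Longrightarrow> prod.swap y \<in> boundary_exponents k"
    by blast+
qed auto

section \<open>The recursion in \<open>k\<close> and the induction\<close>

definition weight :: "'a::comm_semiring_1 \<Rightarrow> 'a \<Rightarrow> int \<times> int \<Rightarrow> 'a" where
  "weight q t = (\<lambda>(m, n). q ^ nat m * t ^ nat n)"

lemma weight_swap: "weight q t (prod.swap y) = weight t q y"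
  by (cases y) (simp add: weight_def mult.commute)

lemma exponents_nonneg:
  assumes "x \<in> triples k"
  shows "0 \<le> fst (exponents k x)" "0 \<le> snd (exponents k x)"
  using assms by (auto simp: triples_def exponents_def area_formula_def bounce_formula_nonneg)

text \<open>Undoing the shift respects the bound on \<open>a + b\<close> automatically. It can fail
  only through \<open>b < 2\<close> or because the bounds on \<open>a\<close> and on
  \<open>a + b + c\<close> each lose one unit; these are the boundary conditions.\<close>

lemma triples_decomp:
  "triples (k + 1) = (\<lambda>(a, b, c). (a, b + 2, c)) ` triples k \<union> boundary_triples (k + 1)"
  "(\<lambda>(a, b, c). (a, b + 2, c)) ` triples k \<inter> boundary_triples (k + 1) = {}"
proof -
  have "(a, b, c) \<in> (\<lambda>(a, b, c). (a, b + 2, c)) ` triples k" if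
    "(a, b, c) \<in> triples (k + 1)" "(a, b, c) \<notin> boundary_triples (k + 1)" for a b c
    using that by (intro image_eqI[where x = "(a, b - 2, c)"])
      (auto simp: triples_def boundary_triples_def)
  then show "triples (k + 1) = (\<lambda>(a, b, c). (a, b + 2, c)) ` triples k \<union> boundary_triples (k + 1)"
    by (auto simp: boundary_triples_def) (auto simp: triples_def)
  show "(\<lambda>(a, b, c). (a, b + 2, c)) ` triples k \<inter> boundary_triples (k + 1) = {}"
    by (auto simp: boundary_triples_def triples_def)
qed

lemma sum_triples_Suc:
  "(\<Sum>x\<in>triples (k + 1). weight q t (exponents (k + 1) x)) =
    q\<^sup>2 * t\<^sup>2 * (\<Sum>x\<in>triples k. weight q t (exponents k x)) +
    sum (weight q t) (boundary_exponents (k + 1))"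
proof -
  let ?s = "\<lambda>(a, b, c). (a, b + 2, c) :: int \<times> int \<times> int"
  have shift: "weight q t (exponents (k + 1) (?s x)) = q\<^sup>2 * t\<^sup>2 * weight q t (exponents k x)"
    if "x \<in> triples k" for x
  proof -
    obtain a b c where x: "x = (a, b, c)" by (cases x)
    define m n where "m = area_formula k a b c" and "n = bounce_formula k a b c"
    \<comment> \<open>The signs are needed to split \<open>nat (m + 2)\<close> into
      \<open>nat m + 2\<close>, and likewise for \<open>n\<close>.\<close>
    then have "0 \<le> m" "0 \<le> n"
      using exponents_nonneg[OF that] by (simp_all add: x exponents_def)
    moreover have "exponents k x = (m, n)" "exponents (k + 1) (?s x) = (m + 2, n + 2)"
      by (simp_all add: x exponents_def m_def n_def bounce_formula_shift area_formula_def)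
    ultimately show ?thesis
      by (simp add: weight_def nat_add_distrib power2_eq_square mult_ac)
  qed
  have "finite (?s ` triples k)" "finite (boundary_triples (k + 1))"
    using finite_triples[of k] finite_triples[of "k + 1"] triples_decomp(1)[of k] by simp_all
  moreover have "inj_on ?s (triples k)"
    by (auto simp: inj_on_def)
  ultimately show ?thesis
    by (simp add: triples_decomp sum.union_disjoint sum.reindex shift sum_distrib_left
        sum_boundary_triples cong: sum.cong)
qed

lemma sum_triples_commute:
  "(\<Sum>x\<in>triples (int k). weight q t (exponents (int k) x)) =
   (\<Sum>x\<in>triples (int k). weight t q (exponents (int k) x))"
proof (induction k)
  case 0
  have "triples 0 = {(0, 0, 0)}"
    by (auto simp: triples_def)
  then show ?case
    by (simp add: weight_def exponents_def area_formula_def bounce_formula_def)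
next
  case (Suc k)
  have "sum (weight q t) (boundary_exponents (int k + 1)) =
      sum (weight t q) (boundary_exponents (int k + 1))"
    using sum_boundary_exponents_swap[of "weight q t"] by (simp add: weight_swap)
  then show ?case
    using Suc.IH by (simp add: sum_triples_Suc add.commute[of 1] mult.commute[of "t\<^sup>2"])
qed

section \<open>Transfer from Dyck paths to integer triples\<close>

lemma qt_catalan_eq_sum_triples:
  "qt_catalan k q t = (\<Sum>x\<in>triples (int k). weight q t (exponents (int k) x))"
proof -
  have "qt_catalan k q t = (\<Sum>p\<in>dyck_paths k. (\<lambda>(a, b, c).
      weight q t (exponents (int k) (int a, int b, int c))) (params p))"
    unfolding qt_catalan_def
    by (rule sum.cong) (auto simp: weight_def exponents_def area_def bounce_def split: prod.split)
  also have "\<dots> = (\<Sum>(a, b, c)\<in>param_triples k. weight q t (exponents (int k) (int a, int b, int c)))"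
    by (rule sum.reindex_bij_betw[OF bij_betw_params])
  also have "\<dots> = (\<Sum>x\<in>triples (int k). weight q t (exponents (int k) x))"
    by (rule sum.reindex_bij_witness[where
          j = "\<lambda>(a, b, c). (int a, int b, int c)" and i = "\<lambda>(a, b, c). (nat a, nat b, nat c)"])
      (auto simp: param_triples_def triples_def)
  finally show ?thesis .
qed

theorem mainTheorem3:
  fixes k :: nat
  assumes "k > 0"
  shows "qt_catalan k var_q var_t = qt_catalan k var_t var_q"
  unfolding qt_catalan_eq_sum_triples by (rule sum_triples_commute)

end
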